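(* Let $F:\mathbb{R}^d\to\mathbb{R}$ be a function that is separately convex and positively homogeneous of order one. Then $F(x)\ge 0$ for all $x\in\mathbb{R}^d$.
   Context: A function $F:\mathbb{R}^d\to\mathbb{R}$ is separately convex if it is convex with respect to each variable (with the other variables fixed). Positively homogeneous of order one means, in this paper's convention, $F(\lambda x)=|\lambda|F(x)$ for all $\lambda\in\mathbb{R}$ and $x\in\mathbb{R}^d$. *)

theory Defs
  imports "HOL-Analysis.Analysis"
begin

definition separately_convex :: "(real ^ 'n \<Rightarrow> real) \<Rightarrow> bool" where
  "separately_convex F \<longleftrightarrow>
     (\<forall>x i. convex_on UNIV (\<lambda>t. F (\<chi> j. if j = i then t else x $ j)))"

(* The scalar ranges over all reals and enters through its absolute value, so F is in particular
   even.  This is stronger than the usual notion, which only involves nonnegative scalars. *)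
definition pos_homogeneous_one :: "(real ^ 'n \<Rightarrow> real) \<Rightarrow> bool" where
  "pos_homogeneous_one F \<longleftrightarrow> (\<forall>(c::real) x. F (c *\<^sub>R x) = \<bar>c\<bar> * F x)"

end

(* If f is separately convex and f (c x) = c f x for c > 0, then t |-> f (y + t b) - t f b is, for
   every basis vector b, convex and bounded for large t, hence nonincreasing and convergent.  Its
   limit G y <= f y is again separately convex and homogeneous, and it is affine in the direction b.
   Doing this for one basis vector after the other yields a linear function below f.  If f is even
   and bounded below by l, it is also bounded below by -l, hence nonnegative. *)
theory Submission
  imports Defs
begin

section \<open>Convexity along the axes and a Lipschitz estimate\<close>

text \<open>A segment is given by an endpoint, a signed length and a basis direction. This avoids
  replacing coordinates, and the inequality passes directly to pointwise limits.\<close>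

definition basis_convex :: "('a::euclidean_space \<Rightarrow> real) \<Rightarrow> bool" where
  "basis_convex f \<longleftrightarrow> (\<forall>x a u. \<forall>b\<in>Basis. 0 \<le> u \<longrightarrow> u \<le> 1 \<longrightarrow>
     f (x + (u * a) *\<^sub>R b) \<le> (1 - u) * f x + u * f (x + a *\<^sub>R b))"

text \<open>Only positive scalars occur, because the minorants built below inherit this property but
  are in general not even.\<close>

definition homogeneous_one :: "('a::real_vector \<Rightarrow> real) \<Rightarrow> bool" where
  "homogeneous_one f \<longleftrightarrow> (\<forall>c x. c > 0 \<longrightarrow> f (c *\<^sub>R x) = c * f x)"

lemma basis_convexD:
  assumes "basis_convex f" "b \<in> Basis" "0 \<le> u" "u \<le> 1"
  shows "f (x + (u * a) *\<^sub>R b) \<le> (1 - u) * f x + u * f (x + a *\<^sub>R b)"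
  using assms unfolding basis_convex_def by blast

lemma homogeneous_oneD: "homogeneous_one f \<Longrightarrow> c > 0 \<Longrightarrow> f (c *\<^sub>R x) = c * f x"
  unfolding homogeneous_one_def by blast

text \<open>Coordinates are added one at a time. In the new direction, one chord bounds the
  increment from above and an opposite chord bounds it from below. The far ends of these chords move
  with \<open>e\<close>, and the induction hypothesis at other base points keeps \<open>f\<close>
  bounded there; hence \<open>x\<close> is arbitrary.\<close>

lemma basis_convex_lipschitz_on_segment:
  assumes f: "basis_convex f" and "finite A" "A \<subseteq> Basis"
  shows "\<exists>C\<ge>0. \<forall>e. 0 \<le> e \<and> e \<le> 1 \<longrightarrow> \<bar>f (x + e *\<^sub>R (\<Sum>b\<in>A. y b *\<^sub>R b)) - f x\<bar> \<le> C * e"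
  using assms(2,3)
proof (induction A arbitrary: x rule: finite_induct)
  case empty
  then show ?case by (intro exI[of _ 0]) auto
next
  case (insert b A)
  have b: "b \<in> Basis" using insert by auto
  define v where "v = (\<Sum>b\<in>A. y b *\<^sub>R b)"
  have "\<exists>C\<ge>0. \<forall>e. 0 \<le> e \<and> e \<le> 1 \<longrightarrow> \<bar>f (x + e *\<^sub>R v) - f x\<bar> \<le> C * e" for x
    using insert.IH insert.prems unfolding v_def by simp
  then obtain K where K0: "\<And>x. K x \<ge> 0"
    and K: "\<And>x e. 0 \<le> e \<Longrightarrow> e \<le> 1 \<Longrightarrow> \<bar>f (x + e *\<^sub>R v) - f x\<bar> \<le> K x * e"
    by metis
  have K1: "\<bar>f (x + e *\<^sub>R v)\<bar> \<le> \<bar>f x\<bar> + K x" if "0 \<le> e" "e \<le> 1" for x e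
    using K[OF that, of x] mult_left_mono[OF that(2) K0[of x]] by simp
  \<comment> \<open>A full step forwards and a full step backwards in direction \<open>b\<close>;
    they start the far ends \<open>p + e *\<^sub>R v\<close> and \<open>q + e *\<^sub>R v\<close> of
    the two chords.\<close>
  define p q where "p = x + y b *\<^sub>R b" and "q = x - y b *\<^sub>R b"
  define D where "D = (\<bar>f p\<bar> + K p) + (\<bar>f q\<bar> + K q) + (\<bar>f x\<bar> + K x) + K x"
  have "\<bar>f (x + e *\<^sub>R (\<Sum>b\<in>insert b A. y b *\<^sub>R b)) - f x\<bar> \<le> D * e" if e: "0 \<le> e" "e \<le> 1" for e
  proof -
    define z w where "z = x + e *\<^sub>R v" and "w = z + (e * y b) *\<^sub>R b"
    have w: "x + e *\<^sub>R (\<Sum>b\<in>insert b A. y b *\<^sub>R b) = w"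
      using insert.hyps by (simp add: w_def z_def v_def algebra_simps)
    have "f w \<le> (1 - e) * f z + e * f (p + e *\<^sub>R v)"
      using basis_convexD[OF f b e, of z "y b"]
      by (simp add: w_def z_def p_def algebra_simps)
    then have "f w - f z \<le> e * (f (p + e *\<^sub>R v) - f z)"
      by (simp add: algebra_simps)
    also have "\<dots> \<le> e * ((\<bar>f p\<bar> + K p) + (\<bar>f x\<bar> + K x))"
      using K1[OF e, of p] K1[OF e, of x] e by (intro mult_left_mono) (auto simp: z_def)
    finally have up: "f w - f z \<le> e * ((\<bar>f p\<bar> + K p) + (\<bar>f x\<bar> + K x))" .
    \<comment> \<open>From \<open>w\<close> to \<open>q + e *\<^sub>R v\<close> the signed length is
      \<open>- (1 + e) * y b\<close>, and \<open>z\<close> is reached after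
      \<open>- e * y b\<close>, so \<open>z\<close> divides this segment in the ratio
      \<open>u\<close>.\<close>
    define u where "u = e / (1 + e)"
    have u: "0 \<le> u" "u \<le> 1" "(1 + e) * u = e" "(1 + e) * (1 - u) = 1" "u * (1 + e) = e"
      using e by (auto simp: u_def field_simps)
    have "u * (- (1 + e) * y b) = - (u * (1 + e)) * y b" by (simp only: mult_ac mult_minus_left mult_minus_right)
    then have "z = w + (u * (- (1 + e) * y b)) *\<^sub>R b"
      unfolding u(5) by (simp add: w_def)
    moreover have "q + e *\<^sub>R v = w + (- (1 + e) * y b) *\<^sub>R b"
      by (simp add: w_def z_def q_def algebra_simps)
    ultimately have "f z \<le> (1 - u) * f w + u * f (q + e *\<^sub>R v)"
      using basis_convexD[OF f b u(1,2), of w "- (1 + e) * y b"] by simp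
    then have "(1 + e) * f z \<le> (1 + e) * ((1 - u) * f w + u * f (q + e *\<^sub>R v))"
      using e by (intro mult_left_mono) auto
    also have "\<dots> = ((1 + e) * (1 - u)) * f w + ((1 + e) * u) * f (q + e *\<^sub>R v)"
      by (simp add: algebra_simps)
    also have "\<dots> = f w + e * f (q + e *\<^sub>R v)" unfolding u(3,4) by simp
    finally have "f z - f w \<le> e * (f (q + e *\<^sub>R v) - f z)"
      by (simp add: algebra_simps)
    also have "\<dots> \<le> e * ((\<bar>f q\<bar> + K q) + (\<bar>f x\<bar> + K x))"
      using K1[OF e, of q] K1[OF e, of x] e by (intro mult_left_mono) (auto simp: z_def)
    finally have lo: "f z - f w \<le> e * ((\<bar>f q\<bar> + K q) + (\<bar>f x\<bar> + K x))" .
    have zx: "\<bar>f z - f x\<bar> \<le> K x * e" using K[OF e, of x] by (simp add: z_def)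
    have nonneg: "0 \<le> e * (\<bar>f p\<bar> + K p)" "0 \<le> e * (\<bar>f q\<bar> + K q)"
      using e K0 by (auto intro!: mult_nonneg_nonneg add_nonneg_nonneg)
    show ?thesis using up lo zx nonneg unfolding w D_def
      by (simp add: algebra_simps abs_le_iff)
  qed
  moreover have "D \<ge> 0" using K0 by (simp add: D_def)
  ultimately show ?case by blast
qed

section \<open>Bounded convex functions of one real variable\<close>

text \<open>The point \<open>t\<close> lies at fraction \<open>u\<close> of the chord from
  \<open>s\<close> to the distant point \<open>s + (t - s) / u\<close>, where \<open>g\<close> is at
  most \<open>C\<close>. As \<open>u\<close> tends to 0, the chord bound at \<open>t\<close> tends
  to \<open>g s\<close>.\<close>

lemma bounded_convex_nonincreasing:
  fixes g :: "real \<Rightarrow> real"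
  assumes conv: "\<And>s a u. 0 \<le> u \<Longrightarrow> u \<le> 1 \<Longrightarrow> g (s + u * a) \<le> (1 - u) * g s + u * g (s + a)"
    and bdd: "\<And>t. t \<ge> 1 \<Longrightarrow> g t \<le> C"
    and "s \<le> t"
  shows "g t \<le> g s"
proof (cases "s = t")
  case False
  then have st: "s < t" using \<open>s \<le> t\<close> by simp
  have "((\<lambda>u. (1 - u) * g s + u * C) \<longlongrightarrow> (1 - 0) * g s + 0 * C) (at_right 0)"
    by (intro tendsto_intros)
  then have lim: "((\<lambda>u. (1 - u) * g s + u * C) \<longlongrightarrow> g s) (at_right 0)" by simp
  \<comment> \<open>For \<open>u < d\<close> the weight is at most 1 and the distant point is at
    least \<open>s + 1 + \<bar>s\<bar>\<close>, hence at least 1, where the bound \<open>C\<close>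
    applies.\<close>
  define d where "d = min 1 ((t - s) / (1 + \<bar>s\<bar>))"
  have "d > 0" using st by (auto simp: d_def)
  have "g t \<le> (1 - u) * g s + u * C" if u: "0 < u" "u < d" for u
  proof -
    have "u \<le> 1" "u < (t - s) / (1 + \<bar>s\<bar>)" using u by (auto simp: d_def)
    then have "u * (1 + \<bar>s\<bar>) \<le> t - s" by (simp add: field_simps)
    then have "1 + \<bar>s\<bar> \<le> (t - s) / u" using u by (simp add: field_simps)
    then have "g (s + (t - s) / u) \<le> C" by (intro bdd) linarith
    moreover have "g t \<le> (1 - u) * g s + u * g (s + (t - s) / u)"
      using conv[of u s "(t - s) / u"] u \<open>u \<le> 1\<close> by simp
    ultimately show ?thesis using mult_left_mono[of "g (s + (t - s) / u)" C u] u by linarith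
  qed
  then have "\<forall>\<^sub>F u in at_right 0. g t \<le> (1 - u) * g s + u * C"
    using \<open>d > 0\<close> unfolding eventually_at_right_field by blast
  then show ?thesis
    using tendsto_lowerbound[OF lim] by simp
qed simp

lemma antimono_bounded_below_tendsto_at_top:
  fixes g :: "real \<Rightarrow> real"
  assumes anti: "\<And>s t. s \<le> t \<Longrightarrow> g t \<le> g s" and bdd: "\<And>t. t \<ge> 1 \<Longrightarrow> L \<le> g t"
  shows "\<exists>l. (g \<longlongrightarrow> l) at_top"
proof -
  have L: "L \<le> g t" for t
    using bdd[of "max 1 t"] anti[of t "max 1 t"] by simp
  have bb: "bdd_below (range g)" using L by (auto intro!: bdd_belowI)
  have "(g \<longlongrightarrow> (INF t. g t)) at_top"
  proof (rule decreasing_tendsto)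
    show "\<forall>\<^sub>F t in at_top. (INF t. g t) \<le> g t"
      by (intro always_eventually allI cINF_lower[OF bb]) simp
    fix x assume "(INF t. g t) < x"
    then obtain s where "g s < x" using bb by (auto simp: cINF_less_iff)
    then show "\<forall>\<^sub>F t in at_top. g t < x"
      unfolding eventually_at_top_linorder by (meson anti le_less_trans)
  qed
  then show ?thesis by blast
qed

section \<open>Minorants that are affine in given directions\<close>

text \<open>The last conclusion makes the construction repeatable: a direction in which
  \<open>f\<close> is already affine keeps its slope when \<open>f\<close> is replaced by
  \<open>G\<close>.\<close>

lemma affine_in_direction_minorant:
  fixes f :: "'a::euclidean_space \<Rightarrow> real"
  assumes f: "basis_convex f" and h: "homogeneous_one f" and b: "b \<in> Basis"
  obtains G where "basis_convex G" "homogeneous_one G" "\<And>x. G x \<le> f x"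
    "\<And>x s. G (x + s *\<^sub>R b) = G x + s * f b"
    "\<And>c k x s. \<forall>x s. f (x + s *\<^sub>R c) = f x + s * k \<Longrightarrow> G (x + s *\<^sub>R c) = G x + s * k"
proof -
  define g where "g y t = f (y + t *\<^sub>R b) - t * f b" for y t
  have bound: "\<exists>C. \<forall>t\<ge>1. \<bar>g y t\<bar> \<le> C" for y
  proof -
    obtain C where C: "\<And>e. 0 \<le> e \<Longrightarrow> e \<le> 1 \<Longrightarrow> \<bar>f (b + e *\<^sub>R y) - f b\<bar> \<le> C * e"
      using basis_convex_lipschitz_on_segment[OF f finite_Basis order_refl, of b "\<lambda>b. y \<bullet> b"]
      by (auto simp: euclidean_representation)
    have "\<bar>g y t\<bar> \<le> C" if "t \<ge> 1" for t
    proof -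
      \<comment> \<open>Homogeneity trades a point far out along \<open>b\<close> for one near
        \<open>b\<close>. The Lipschitz estimate there, with \<open>e = 1 / t\<close>, is of order
        \<open>1 / t\<close> and compensates the factor \<open>t\<close>.\<close>
      have "y + t *\<^sub>R b = t *\<^sub>R (b + (1 / t) *\<^sub>R y)"
        using that by (simp add: algebra_simps)
      then have "g y t = t * (f (b + (1 / t) *\<^sub>R y) - f b)"
        using homogeneous_oneD[OF h, of t "b + (1 / t) *\<^sub>R y"] that
        by (simp add: g_def algebra_simps)
      then have "\<bar>g y t\<bar> = t * \<bar>f (b + (1 / t) *\<^sub>R y) - f b\<bar>"
        using that by (simp add: abs_mult)
      also have "\<dots> \<le> t * (C * (1 / t))"
        using C[of "1 / t"] that by (intro mult_left_mono) auto
      finally show ?thesis using that by simp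
    qed
    then show ?thesis by blast
  qed
  have conv: "g y (s + u * a) \<le> (1 - u) * g y s + u * g y (s + a)" if "0 \<le> u" "u \<le> 1" for y s a u
    using basis_convexD[OF f b that, of "y + s *\<^sub>R b" a] by (simp add: g_def algebra_simps)
  have anti: "g y t \<le> g y s" if st: "s \<le> t" for y s t
  proof -
    obtain C where C: "\<forall>t\<ge>1. \<bar>g y t\<bar> \<le> C" using bound by blast
    then have "g y t \<le> C" if "t \<ge> 1" for t using that abs_le_D1 by blast
    then show ?thesis using bounded_convex_nonincreasing[of "g y", OF conv _ st] by blast
  qed
  have "\<exists>l. (g y \<longlongrightarrow> l) at_top" for y
  proof -
    obtain C where C: "\<forall>t\<ge>1. \<bar>g y t\<bar> \<le> C" using bound by blast
    then have "- C \<le> g y t" if "t \<ge> 1" for t using that by (metis abs_le_D2 minus_le_iff)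
    then show ?thesis using antimono_bounded_below_tendsto_at_top[of "g y", OF anti] by blast
  qed
  then obtain G where G: "\<And>y. (g y \<longlongrightarrow> G y) at_top" by metis
  show ?thesis
  proof
    show "basis_convex G"
      unfolding basis_convex_def
    proof (intro allI ballI impI)
      fix x :: 'a and a u :: real and c :: 'a
      assume c: "c \<in> Basis" and u: "0 \<le> u" "u \<le> 1"
      have "g (x + (u * a) *\<^sub>R c) t \<le> (1 - u) * g x t + u * g (x + a *\<^sub>R c) t" for t
        using basis_convexD[OF f c u, of "x + t *\<^sub>R b" a] by (simp add: g_def algebra_simps)
      then show "G (x + (u * a) *\<^sub>R c) \<le> (1 - u) * G x + u * G (x + a *\<^sub>R c)"
        by (intro tendsto_le[OF trivial_limit_at_top_linorder _ G, of
              "\<lambda>t. (1 - u) * g x t + u * g (x + a *\<^sub>R c) t"])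
           (auto intro!: tendsto_add tendsto_mult tendsto_const G)
    qed
    show "homogeneous_one G"
      unfolding homogeneous_one_def
    proof (intro allI impI)
      fix c :: real and x :: 'a
      assume c: "c > 0"
      \<comment> \<open>Scaling the point also scales the parameter; since \<open>c * t\<close>
        still tends to infinity, the limit is not affected.\<close>
      have "g (c *\<^sub>R x) (c * t) = c * g x t" for t
        using homogeneous_oneD[OF h c, of "x + t *\<^sub>R b"] by (simp add: g_def algebra_simps)
      moreover have "filterlim (\<lambda>t. c * t) at_top at_top"
        using c by (intro filterlim_tendsto_pos_mult_at_top[OF tendsto_const _ filterlim_ident])
      ultimately have "((\<lambda>t. c * g x t) \<longlongrightarrow> G (c *\<^sub>R x)) at_top"
        using filterlim_compose[OF G[of "c *\<^sub>R x"], of "\<lambda>t. c * t" at_top] by simp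
      then show "G (c *\<^sub>R x) = c * G x"
        by (rule tendsto_unique[OF trivial_limit_at_top_linorder]) (intro tendsto_intros G)
    qed
    show "G x \<le> f x" for x
    proof (rule tendsto_upperbound[OF G])
      show "\<forall>\<^sub>F t in at_top. g x t \<le> f x"
        using eventually_ge_at_top[of 0]
      proof eventually_elim
        case (elim t)
        then show ?case using anti[of 0 t x] by (simp add: g_def)
      qed
    qed simp
    show "G (x + s *\<^sub>R b) = G x + s * f b" for x s
    proof -
      \<comment> \<open>A translation along \<open>b\<close> is a shift of the parameter, up to the
        correction \<open>s * f b\<close> from the subtracted linear term.\<close>
      have "g x (s + t) + s * f b = g (x + s *\<^sub>R b) t" for t
        by (simp add: g_def algebra_simps)
      moreover have "((\<lambda>t. g x (s + t)) \<longlongrightarrow> G x) at_top"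
        by (rule filterlim_compose[OF G])
           (rule filterlim_tendsto_add_at_top[OF tendsto_const filterlim_ident])
      ultimately have "(g (x + s *\<^sub>R b) \<longlongrightarrow> G x + s * f b) at_top"
        using tendsto_add[OF _ tendsto_const, of "\<lambda>t. g x (s + t)" "G x" at_top "s * f b"] by simp
      then show ?thesis
        by (rule tendsto_unique[OF trivial_limit_at_top_linorder G])
    qed
    show "G (x + s *\<^sub>R c) = G x + s * k"
      if "\<forall>x s. f (x + s *\<^sub>R c) = f x + s * k" for c k x s
    proof -
      have "g (x + s *\<^sub>R c) = (\<lambda>t. g x t + s * k)"
        using that[rule_format, of "x + t *\<^sub>R b" s for t] by (simp add: g_def fun_eq_iff algebra_simps)
      then have "(g (x + s *\<^sub>R c) \<longlongrightarrow> G x + s * k) at_top"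
        using tendsto_add[OF G tendsto_const, of x "s * k"] by simp
      then show ?thesis
        by (rule tendsto_unique[OF trivial_limit_at_top_linorder G])
    qed
  qed
qed

lemma affine_in_directions_minorant:
  fixes f :: "'a::euclidean_space \<Rightarrow> real"
  assumes "basis_convex f" "homogeneous_one f" "finite A" "A \<subseteq> Basis"
  shows "\<exists>G k. basis_convex G \<and> homogeneous_one G \<and> (\<forall>x. G x \<le> f x) \<and>
    (\<forall>b\<in>A. \<forall>x s. G (x + s *\<^sub>R b) = G x + s * k b)"
  using assms(3,4)
proof (induction A rule: finite_induct)
  case empty
  then show ?case using assms by auto
next
  case (insert b A)
  then obtain G k where G: "basis_convex G" "homogeneous_one G" "\<And>x. G x \<le> f x"
    and k: "\<And>c x s. c \<in> A \<Longrightarrow> G (x + s *\<^sub>R c) = G x + s * k c"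
    by (metis insert_subset)
  obtain H where H: "basis_convex H" "homogeneous_one H" "\<And>x. H x \<le> G x"
    and Hb: "\<And>x s. H (x + s *\<^sub>R b) = H x + s * G b"
    and Hk: "\<And>c r x s. \<forall>x s. G (x + s *\<^sub>R c) = G x + s * r \<Longrightarrow>
      H (x + s *\<^sub>R c) = H x + s * r"
    using affine_in_direction_minorant[OF G(1,2), of b] insert.prems by auto
  \<comment> \<open>The slope in direction \<open>b\<close> is the value at \<open>b\<close> of the
    current minorant \<open>G\<close>, which may be smaller than \<open>f b\<close>.\<close>
  have "\<forall>c\<in>insert b A. \<forall>x s. H (x + s *\<^sub>R c) = H x + s * (k(b := G b)) c"
    using Hb Hk k insert.hyps by auto
  moreover have "\<forall>x. H x \<le> f x" using H(3) G(3) order_trans by blast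
  ultimately show ?case using H(1,2) by blast
qed

section \<open>Linear minorants and nonnegativity\<close>

text \<open>An analogue of the Hahn-Banach theorem with convexity along the axes only. A minorant
  that is affine in every basis direction is determined by its slopes and its value at 0, and
  homogeneity makes that value vanish.\<close>

theorem basis_convex_homogeneous_linear_minorant:
  fixes f :: "'a::euclidean_space \<Rightarrow> real"
  assumes "basis_convex f" "homogeneous_one f"
  shows "\<exists>a. \<forall>x. a \<bullet> x \<le> f x"
proof -
  obtain G k where G: "homogeneous_one G" "\<And>x. G x \<le> f x"
    and k: "\<And>b x s. b \<in> Basis \<Longrightarrow> G (x + s *\<^sub>R b) = G x + s * k b"
    using affine_in_directions_minorant[OF assms finite_Basis order_refl] by blast
  have "G 0 = 0" using homogeneous_oneD[OF G(1), of 2 0] by simp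
  have "G (\<Sum>b\<in>A. y b *\<^sub>R b) = (\<Sum>b\<in>A. y b * k b)" if "finite A" "A \<subseteq> Basis" for A y
    using that
  proof (induction A rule: finite_induct)
    case empty
    then show ?case using \<open>G 0 = 0\<close> by simp
  next
    case (insert b A)
    then show ?case using k[of b "\<Sum>b\<in>A. y b *\<^sub>R b" "y b"] by (simp add: add.commute)
  qed
  from this[OF finite_Basis order_refl, of "\<lambda>b. x \<bullet> b" for x]
  have "G x = (\<Sum>b\<in>Basis. k b *\<^sub>R b) \<bullet> x" for x
    by (simp add: euclidean_representation inner_sum_left inner_commute[of x] mult.commute)
  then show ?thesis using G(2) by metis
qed

lemma separately_convex_imp_basis_convex:
  fixes F :: "real ^ 'n \<Rightarrow> real"
  assumes "separately_convex F"
  shows "basis_convex F"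
  unfolding basis_convex_def
proof (intro allI ballI impI)
  fix x b :: "real ^ 'n" and a u :: real
  assume "b \<in> Basis" and u: "0 \<le> u" "u \<le> 1"
  then obtain i where b: "b = axis i 1" by (auto simp: Basis_vec_def)
  define g where "g t = F (\<chi> j. if j = i then t else x $ j)" for t
  \<comment> \<open>Moving along the axis changes only coordinate \<open>i\<close>, so the chord in
    question is that of \<open>g\<close> between \<open>x $ i\<close> and \<open>x $ i + a\<close>;
    the case \<open>t = 0\<close> recovers \<open>F x\<close>.\<close>
  have g: "F (x + t *\<^sub>R b) = g (x $ i + t)" for t
    unfolding g_def by (rule arg_cong[where f = F]) (simp add: vec_eq_iff b axis_def)
  have "convex_on UNIV g"
    using assms unfolding separately_convex_def g_def by blast
  from convex_onD[OF this u, of "x $ i" "x $ i + a"]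
  show "F (x + (u * a) *\<^sub>R b) \<le> (1 - u) * F x + u * F (x + a *\<^sub>R b)"
    using g[of 0] by (simp add: g algebra_simps)
qed

theorem theorem4:
  fixes F :: "real ^ 'n \<Rightarrow> real"
  assumes "separately_convex F"
    and "pos_homogeneous_one F"
  shows "\<forall>x. F x \<ge> 0"
proof
  fix x
  have h: "F (c *\<^sub>R y) = \<bar>c\<bar> * F y" for c y
    using assms(2) unfolding pos_homogeneous_one_def by blast
  then have "homogeneous_one F" unfolding homogeneous_one_def by simp
  then obtain a where a: "\<And>y. a \<bullet> y \<le> F y"
    using basis_convex_homogeneous_linear_minorant[OF separately_convex_imp_basis_convex]
      assms(1) by blast
  \<comment> \<open>By evenness both \<open>a \<bullet> x\<close> and its negative are at most
    \<open>F x\<close>.\<close>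
  have "F (- x) = F x" using h[of "- 1" x] by simp
  then show "F x \<ge> 0" using a[of x] a[of "- x"] by simp
qed

end
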